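(* Let $K\subset\mathbb{R}^2$ be a closed convex body whose boundary has unit speed counter-clockwise parametrization $\boldsymbol\sigma(u)$, $u\in\mathbb{R}$. Suppose $\boldsymbol\sigma$ is twice differentiable and $c(t)$ is a differentiable trajectory in $\Omega=\mathbb{R}^2\setminus K$. Write $c(t)=\boldsymbol\sigma(u(t))-r(t)\,\mathbf{n}(u(t))$, where $r(t)>0$ is the distance from $c(t)$ to $K$ and $\boldsymbol\sigma(u(t))$ is the point of $K$ nearest to $c(t)$. Then $u$ and $r$ are differentiable in $t$ and $$\dot u=\frac{\boldsymbol\sigma'(u)\cdot\dot c}{1+r\,\kappa(u)},\qquad \dot r=-\mathbf{n}(u)\cdot\dot c ,$$ where $x\cdot y$ is the standard inner product in $\mathbb{R}^2$.
   Context: A closed convex body is a closed convex set with nonempty interior. Unit speed means $|\boldsymbol\sigma'(u)|=1$ for all $u$. $\mathbf{n}(u)$ is the unit vector normal to $\boldsymbol\sigma'(u)$ pointing into $K$, so that $(\boldsymbol\sigma'(u),\mathbf{n}(u))$ is a right-handed orthonormal frame (this is the meaning of counter-clockwise). The curvature $\kappa(u)$ is defined by $\boldsymbol\sigma''(u)=\kappa(u)\,\mathbf{n}(u)$; it is nonnegative by convexity of $K$. The parameter $u(t)$ of the nearest point is chosen continuous in $t$. A dot denotes the derivative with respect to $t$ and an accent the derivative with respect to $u$. *)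

theory Defs
  imports "HOL-Analysis.Analysis"
begin

definition tangent :: "(real \<Rightarrow> real^2) \<Rightarrow> real \<Rightarrow> real^2" where
  "tangent \<sigma> u = vector_derivative \<sigma> (at u)"

text \<open>The tangent turned by +90 degrees: for a unit speed curve this is the unique vector
  making (tangent, normal) a right-handed orthonormal frame.\<close>

definition left_normal :: "(real \<Rightarrow> real^2) \<Rightarrow> real \<Rightarrow> real^2" where
  "left_normal \<sigma> u = vector [- (tangent \<sigma> u $ 2), tangent \<sigma> u $ 1]"

definition points_into :: "(real^2) set \<Rightarrow> real^2 \<Rightarrow> real^2 \<Rightarrow> bool" where
  "points_into K p v \<longleftrightarrow> (\<exists>\<epsilon>>0. \<forall>s. 0 < s \<and> s < \<epsilon> \<longrightarrow> p + s *\<^sub>R v \<in> K)"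

text \<open>Neither injectivity nor periodicity is required: the boundary of a bounded body is
  traversed periodically, that of an unbounded one injectively.\<close>

definition ccw_unit_speed_boundary :: "(real^2) set \<Rightarrow> (real \<Rightarrow> real^2) \<Rightarrow> bool" where
  "ccw_unit_speed_boundary K \<sigma> \<longleftrightarrow>
     range \<sigma> = frontier K \<and>
     (\<forall>u. \<sigma> differentiable (at u)) \<and>
     (\<forall>u. norm (tangent \<sigma> u) = 1) \<and>
     (\<forall>u. points_into K (\<sigma> u) (left_normal \<sigma> u))"

text \<open>Meaningful for twice differentiable unit speed curves, where the second derivative is
  orthogonal to the tangent and hence a unique multiple of the normal.\<close>

definition curvature :: "(real \<Rightarrow> real^2) \<Rightarrow> real \<Rightarrow> real" where
  "curvature \<sigma> u = (THE k. vector_derivative (tangent \<sigma>) (at u) = k *\<^sub>R left_normal \<sigma> u)"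

end

theory Submission
  imports Defs
begin

text \<open>Write \<open>\<tau>\<close> and \<open>n\<close> for the tangent and the left normal of \<open>\<sigma>\<close>. The nearest point
  \<open>\<sigma> (u t)\<close> minimises the distance to \<open>c t\<close> along the curve, so \<open>c t - \<sigma> (u t)\<close> is orthogonal
  to \<open>\<tau> (u t)\<close>; in the plane this makes it a multiple of \<open>n (u t)\<close>, and since \<open>n\<close> points into \<open>K\<close> the
  multiple is \<open>- r t\<close> (lemma \<open>outer_point_eq_foot_minus_normal\<close>).

  Fix \<open>t\<^sub>0\<close>, put \<open>u\<^sub>0 = u t\<^sub>0\<close> and consider \<open>h v = (\<sigma> v - c t\<^sub>0) \<bullet> \<tau> v\<close>, the derivative of half the squared
  distance from \<open>c t\<^sub>0\<close>. Orthogonality at time \<open>t\<close> says \<open>h (u t) = (c t - c t\<^sub>0) \<bullet> \<tau> (u t)\<close>, so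
  \<open>h \<circ> u\<close> has derivative \<open>c' t\<^sub>0 \<bullet> \<tau> u\<^sub>0\<close> at \<open>t\<^sub>0\<close> although only the continuity of \<open>u\<close> is known. On the
  other hand \<open>h' u\<^sub>0 = 1 + r t\<^sub>0 * \<kappa> u\<^sub>0\<close>, where \<open>\<kappa> u\<^sub>0 \<ge> 0\<close>: the line through the foot point orthogonal
  to \<open>n u\<^sub>0\<close> supports \<open>K\<close>, so the height of \<open>\<sigma>\<close> above it has a minimum at \<open>u\<^sub>0\<close>, and \<open>\<kappa> u\<^sub>0\<close> is the
  second derivative of that height. As \<open>h' u\<^sub>0\<close> is not zero, \<open>h\<close> can be cancelled from
  \<open>h \<circ> u\<close> (lemma \<open>has_real_derivative_cancel_outer\<close>), which differentiates \<open>u\<close>.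
  Finally \<open>r = (\<sigma> \<circ> u - c) \<bullet> (n \<circ> u)\<close> is differentiated by the product rule; the terms containing \<open>u'\<close>
  vanish because \<open>\<tau> \<bullet> n = 0\<close> and \<open>n \<bullet> n' = 0\<close>.\<close>

section \<open>Derivatives of real functions\<close>

text \<open>If the second derivative were negative, the first would be negative just to the right of
  \<open>a\<close>, and \<open>f\<close> would decrease there.\<close>

lemma second_derivative_nonneg_at_minimum:
  fixes f f' :: "real \<Rightarrow> real"
  assumes f: "\<And>v. (f has_real_derivative f' v) (at v)"
    and f': "(f' has_real_derivative D) (at a)"
    and min: "\<And>v. f a \<le> f v"
  shows "D \<ge> 0"
proof (rule ccontr)
  assume "\<not> D \<ge> 0"
  have "f' a = 0"
    by (rule DERIV_local_min[OF f zero_less_one]) (use min in auto)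
  obtain d where d: "d > 0" "\<And>h. 0 < h \<Longrightarrow> h < d \<Longrightarrow> f' (a + h) < f' a"
    using DERIV_neg_dec_right[OF f'] \<open>\<not> D \<ge> 0\<close> by auto
  obtain z where z: "a < z" "z < a + d / 2" "f (a + d/2) - f a = (a + d/2 - a) * f' z"
    using MVT2[of a "a + d/2" f f'] f d(1) by auto
  have "f' z < 0"
    using d(2)[of "z - a"] z \<open>f' a = 0\<close> d(1) by simp
  then have "f (a + d/2) < f a"
    using z(3) d(1) mult_pos_neg[of "d/2" "f' z"] by simp
  with min[of "a + d/2"] show False by simp
qed

text \<open>A converse of the chain rule. By Caratheodory's form of differentiability,
  \<open>h y - h (u a) = q y * (y - u a)\<close> with \<open>q\<close> continuous and nonzero at \<open>u a\<close>, so the difference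
  quotient of \<open>u\<close> is that of \<open>h \<circ> u\<close> divided by \<open>q \<circ> u\<close>.\<close>

lemma has_real_derivative_cancel_outer:
  fixes h u :: "real \<Rightarrow> real"
  assumes h: "(h has_real_derivative D) (at (u a))" and "D \<noteq> 0"
    and u: "continuous (at a within T) u"
    and hu: "((\<lambda>t. h (u t)) has_real_derivative E) (at a within T)"
  shows "(u has_real_derivative E / D) (at a within T)"
proof -
  obtain q where q: "\<And>y. h y - h (u a) = q y * (y - u a)" "isCont q (u a)" "q (u a) = D"
    using h unfolding CARAT_DERIV by auto
  have "continuous (at a within T) (\<lambda>t. q (u t))"
    by (rule continuous_within_compose3[OF q(2) u])
  then have qu: "((\<lambda>t. q (u t)) \<longlongrightarrow> D) (at a within T)"
    using q(3) by (simp add: continuous_within)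
  have "\<forall>\<^sub>F t in at a within T. q (u t) \<noteq> 0"
    using tendsto_imp_eventually_ne[OF qu \<open>D \<noteq> 0\<close>] .
  then have ev: "\<forall>\<^sub>F t in at a within T.
      (h (u t) - h (u a)) / (t - a) / q (u t) = (u t - u a) / (t - a)"
    by eventually_elim (simp add: q(1))
  have "((\<lambda>t. (h (u t) - h (u a)) / (t - a) / q (u t)) \<longlongrightarrow> E / D) (at a within T)"
    using hu qu \<open>D \<noteq> 0\<close> unfolding has_field_derivative_iff by (intro tendsto_divide)
  then show ?thesis
    unfolding has_field_derivative_iff by (rule Lim_transform_eventually[OF _ ev])
qed

text \<open>At a zero of \<open>f\<close>, the difference quotient of \<open>f \<bullet> g\<close> is that of \<open>f\<close> multiplied by \<open>g t\<close>, so no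
  derivative of \<open>g\<close> enters. This is applied to \<open>c t - c t\<^sub>0\<close> and the tangent at \<open>u t\<close>, before \<open>u\<close>
  is known to be differentiable.\<close>

lemma has_real_derivative_inner_continuous:
  fixes f g :: "real \<Rightarrow> 'a::real_inner"
  assumes f: "(f has_vector_derivative f') (at a within T)" and "f a = 0"
    and g: "continuous (at a within T) g"
  shows "((\<lambda>t. f t \<bullet> g t) has_real_derivative f' \<bullet> g a) (at a within T)"
proof -
  have lim: "((\<lambda>t. norm (f t - f a - (t - a) *\<^sub>R f') / norm (t - a)) \<longlongrightarrow> 0) (at a within T)"
    using f unfolding has_vector_derivative_def has_derivative_iff_norm by blast
  have "\<forall>\<^sub>F t in at a within T.
      norm (f t - f a - (t - a) *\<^sub>R f') / norm (t - a) = norm ((f t - f a) /\<^sub>R (t - a) - f')"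
  proof (unfold eventually_at_filter, intro always_eventually allI impI)
    fix t assume "t \<noteq> a"
    then have "(f t - f a) /\<^sub>R (t - a) - f' = (f t - f a - (t - a) *\<^sub>R f') /\<^sub>R (t - a)"
      by (simp add: scaleR_diff_right)
    then show "norm (f t - f a - (t - a) *\<^sub>R f') / norm (t - a) = norm ((f t - f a) /\<^sub>R (t - a) - f')"
      by (simp add: divide_inverse)
  qed
  from Lim_transform_eventually[OF lim this]
  have "((\<lambda>t. (f t - f a) /\<^sub>R (t - a)) \<longlongrightarrow> f') (at a within T)"
    by (rule LIM_zero_cancel[OF tendsto_norm_zero_cancel])
  then have "((\<lambda>t. ((f t - f a) /\<^sub>R (t - a)) \<bullet> g t) \<longlongrightarrow> f' \<bullet> g a) (at a within T)"
    using g unfolding continuous_within by (rule tendsto_inner)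
  then show ?thesis
    by (simp add: has_field_derivative_iff \<open>f a = 0\<close> divide_inverse mult.commute)
qed

section \<open>The moving frame in the plane\<close>

definition quarter_turn :: "real^2 \<Rightarrow> real^2" where
  "quarter_turn x = vector [- (x $ 2), x $ 1]"

lemma left_normal_eq_quarter_turn: "left_normal \<sigma> v = quarter_turn (tangent \<sigma> v)"
  by (simp add: left_normal_def quarter_turn_def)

lemma bounded_linear_quarter_turn: "bounded_linear quarter_turn"
  unfolding linear_conv_bounded_linear[symmetric]
  by (intro linearI) (simp_all add: quarter_turn_def vec_eq_iff forall_2)

lemma inner_quarter_turn [simp]:
  "x \<bullet> quarter_turn x = 0" "quarter_turn x \<bullet> x = 0"
  "quarter_turn x \<bullet> quarter_turn y = x \<bullet> y"
  by (simp_all add: quarter_turn_def inner_vec_def sum_2)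

lemma orthogonal_to_unit_eq_quarter_turn:
  assumes "norm a = 1" and "x \<bullet> a = 0"
  shows "x = (x \<bullet> quarter_turn a) *\<^sub>R quarter_turn a"
proof -
  have 1: "a $ 1 * a $ 1 + a $ 2 * a $ 2 = 1"
    using assms(1) by (simp add: norm_eq_1 inner_vec_def sum_2)
  have 0: "x $ 1 * a $ 1 + x $ 2 * a $ 2 = 0"
    using assms(2) by (simp add: inner_vec_def sum_2)
  have "x $ 1 - (x $ 2 * a $ 1 - x $ 1 * a $ 2) * - a $ 2 =
      x $ 1 * (1 - (a $ 1 * a $ 1 + a $ 2 * a $ 2)) + a $ 1 * (x $ 1 * a $ 1 + x $ 2 * a $ 2)"
    "x $ 2 - (x $ 2 * a $ 1 - x $ 1 * a $ 2) * a $ 1 =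
      x $ 2 * (1 - (a $ 1 * a $ 1 + a $ 2 * a $ 2)) + a $ 2 * (x $ 1 * a $ 1 + x $ 2 * a $ 2)"
    by (simp_all add: algebra_simps)
  then have "x $ 1 = (x $ 2 * a $ 1 - x $ 1 * a $ 2) * - a $ 2"
    "x $ 2 = (x $ 2 * a $ 1 - x $ 1 * a $ 2) * a $ 1"
    unfolding 0 1 by simp_all
  then show ?thesis
    by (simp add: quarter_turn_def inner_vec_def sum_2 vec_eq_iff forall_2 algebra_simps)
qed

lemma inner_derivative_of_unit_vector:
  fixes f :: "real \<Rightarrow> 'a::real_inner"
  assumes f: "(f has_vector_derivative f') (at a)" and unit: "\<And>v. norm (f v) = 1"
  shows "f' \<bullet> f a = 0"
proof -
  have "((\<lambda>v. f v \<bullet> f v) has_vector_derivative f a \<bullet> f' + f' \<bullet> f a) (at a)"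
    by (rule bounded_bilinear.has_vector_derivative[OF bounded_bilinear_inner f f])
  moreover have "(\<lambda>v. f v \<bullet> f v) = (\<lambda>v. 1)"
    using unit by (simp add: norm_eq_1)
  ultimately have "((\<lambda>v. 1::real) has_vector_derivative f a \<bullet> f' + f' \<bullet> f a) (at a)"
    by simp
  then have "f a \<bullet> f' + f' \<bullet> f a = 0"
    by (rule vector_derivative_unique_at) (rule has_vector_derivative_const)
  then show ?thesis by (simp add: inner_commute)
qed

text \<open>The derivative of the unit tangent has no tangential part, so the number described by
  the definition of the curvature exists.\<close>

lemma tangent_has_vector_derivative_curvature:
  assumes unit: "\<And>v. norm (tangent \<sigma> v) = 1"
    and diff: "tangent \<sigma> differentiable (at v)"
  shows "(tangent \<sigma> has_vector_derivative curvature \<sigma> v *\<^sub>R left_normal \<sigma> v) (at v)"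
proof -
  define \<tau>' where "\<tau>' = vector_derivative (tangent \<sigma>) (at v)"
  have \<tau>': "(tangent \<sigma> has_vector_derivative \<tau>') (at v)"
    unfolding \<tau>'_def by (rule vector_derivative_works[THEN iffD1, OF diff])
  define k where "k = \<tau>' \<bullet> left_normal \<sigma> v"
  have eq: "\<tau>' = k *\<^sub>R left_normal \<sigma> v"
    unfolding k_def left_normal_eq_quarter_turn
    by (intro orthogonal_to_unit_eq_quarter_turn unit
        inner_derivative_of_unit_vector[OF \<tau>' unit])
  have "left_normal \<sigma> v \<bullet> left_normal \<sigma> v = 1"
    using unit[of v] by (simp add: left_normal_eq_quarter_turn norm_eq_1)
  then have "left_normal \<sigma> v \<noteq> 0" by auto
  then have "curvature \<sigma> v = k"
    unfolding curvature_def \<tau>'_def[symmetric] eq by (intro the_equality) auto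
  then show ?thesis using \<tau>' eq by simp
qed

section \<open>Nearest points of a convex body\<close>

text \<open>The squared distance from \<open>x\<close> to \<open>\<sigma> v\<close> is least at \<open>v = a\<close>, so its derivative vanishes
  there: this makes the offset normal. Its sign is fixed by the obtuse angle at the nearest point
  between \<open>x\<close> and any point of \<open>K\<close>, applied to a point slightly along the inward normal.\<close>

lemma outer_point_eq_foot_minus_normal:
  assumes K: "closed K" "convex K" and bd: "ccw_unit_speed_boundary K \<sigma>"
    and foot: "\<sigma> a = closest_point K x"
  shows "x = \<sigma> a - infdist x K *\<^sub>R left_normal \<sigma> a"
proof -
  have unit: "norm (tangent \<sigma> a) = 1"
    and \<sigma>: "(\<sigma> has_vector_derivative tangent \<sigma> a) (at a)"
    and into: "points_into K (\<sigma> a) (left_normal \<sigma> a)"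
    using bd by (auto simp: ccw_unit_speed_boundary_def tangent_def vector_derivative_works)
  have inK: "\<sigma> v \<in> K" for v
    using bd K(1) frontier_subset_closed unfolding ccw_unit_speed_boundary_def by blast
  have d: "dist x (\<sigma> a) = infdist x K"
  proof -
    have "infdist x K = setdist {x} K"
      by (simp add: infdist_eq_setdist)
    also have "\<dots> = dist x (closest_point K x)"
      using setdist_closest_point[OF K(1)] inK by blast
    finally show ?thesis by (simp add: foot)
  qed
  have obtuse: "(x - \<sigma> a) \<bullet> (y - \<sigma> a) \<le> 0" if "y \<in> K" for y
    unfolding foot by (rule closest_point_dot[OF K(2,1) that])
  have perp: "(x - \<sigma> a) \<bullet> tangent \<sigma> a = 0"
  proof -
    have 1: "((\<lambda>v. x - \<sigma> v) has_vector_derivative - tangent \<sigma> a) (at a)"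
      by (auto intro!: derivative_eq_intros \<sigma>)
    have "((\<lambda>v. (x - \<sigma> v) \<bullet> (x - \<sigma> v)) has_vector_derivative
        (x - \<sigma> a) \<bullet> - tangent \<sigma> a + - tangent \<sigma> a \<bullet> (x - \<sigma> a)) (at a)"
      by (rule bounded_bilinear.has_vector_derivative[OF bounded_bilinear_inner 1 1])
    then have "((\<lambda>v. (x - \<sigma> v) \<bullet> (x - \<sigma> v)) has_real_derivative
        (x - \<sigma> a) \<bullet> - tangent \<sigma> a + - tangent \<sigma> a \<bullet> (x - \<sigma> a)) (at a)"
      by (simp add: has_real_derivative_iff_has_vector_derivative)
    moreover have "(x - \<sigma> a) \<bullet> (x - \<sigma> a) \<le> (x - \<sigma> v) \<bullet> (x - \<sigma> v)" for v
      using closest_point_le[OF K(1) inK[of v], of x]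
      by (simp add: foot dist_norm norm_le)
    ultimately have "(x - \<sigma> a) \<bullet> - tangent \<sigma> a + - tangent \<sigma> a \<bullet> (x - \<sigma> a) = 0"
      by (intro DERIV_local_min[OF _ zero_less_one]) auto
    then show ?thesis by (simp add: inner_commute)
  qed
  define l where "l = (x - \<sigma> a) \<bullet> left_normal \<sigma> a"
  have eq: "x - \<sigma> a = l *\<^sub>R left_normal \<sigma> a"
    unfolding l_def left_normal_eq_quarter_turn
    by (rule orthogonal_to_unit_eq_quarter_turn[OF unit perp])
  have nn: "norm (left_normal \<sigma> a) = 1"
    using unit by (simp add: left_normal_eq_quarter_turn norm_eq_1)
  obtain e where e: "e > 0" "\<And>s. 0 < s \<Longrightarrow> s < e \<Longrightarrow> \<sigma> a + s *\<^sub>R left_normal \<sigma> a \<in> K"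
    using into unfolding points_into_def by blast
  have "(e/2) * l \<le> 0"
    using obtuse[OF e(2)[of "e/2"]] e(1) by (simp add: l_def)
  then have "l \<le> 0"
    using e(1) by (simp add: mult_le_0_iff)
  moreover have "\<bar>l\<bar> = infdist x K"
    using d eq nn by (simp add: dist_norm)
  ultimately have "l = - infdist x K" by simp
  then show ?thesis using eq by (simp add: algebra_simps)
qed

text \<open>Since \<open>x\<close> lies outside \<open>K\<close>, the line through \<open>\<sigma> a\<close> orthogonal to \<open>x - \<sigma> a\<close> supports \<open>K\<close>, and
  the left normal is orthogonal to it and points to the side of \<open>K\<close>. Hence the height \<open>\<sigma> v \<bullet> left_normal \<sigma> a\<close>
  is least at \<open>v = a\<close>, and its second derivative there is the curvature.\<close>

lemma curvature_nonneg_at_foot: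
  assumes K: "closed K" "convex K" and bd: "ccw_unit_speed_boundary K \<sigma>"
    and diff: "\<And>v. tangent \<sigma> differentiable (at v)"
    and "x \<notin> K" and foot: "\<sigma> a = closest_point K x"
  shows "curvature \<sigma> a \<ge> 0"
proof -
  have unit: "\<And>v. norm (tangent \<sigma> v) = 1"
    and \<sigma>: "\<And>v. (\<sigma> has_vector_derivative tangent \<sigma> v) (at v)"
    using bd by (auto simp: ccw_unit_speed_boundary_def tangent_def vector_derivative_works)
  have inK: "\<sigma> v \<in> K" for v
    using bd K(1) frontier_subset_closed unfolding ccw_unit_speed_boundary_def by blast
  define n where "n = left_normal \<sigma> a"
  have nn: "n \<bullet> n = 1"
    using unit[of a] by (simp add: n_def left_normal_eq_quarter_turn norm_eq_1)
  have pos: "infdist x K > 0"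
    using infdist_pos_not_in_closed[OF K(1)] inK \<open>x \<notin> K\<close> by blast
  have side: "\<sigma> a \<bullet> n \<le> \<sigma> v \<bullet> n" for v
  proof -
    have "(x - \<sigma> a) \<bullet> (\<sigma> v - \<sigma> a) \<le> 0"
      unfolding foot by (rule closest_point_dot[OF K(2,1) inK])
    moreover have "x - \<sigma> a = - infdist x K *\<^sub>R n"
      using outer_point_eq_foot_minus_normal[OF K bd foot] by (simp add: n_def algebra_simps)
    ultimately have "infdist x K * (n \<bullet> (\<sigma> v - \<sigma> a)) \<ge> 0"
      by simp
    then show ?thesis
      using pos by (simp add: zero_le_mult_iff inner_diff_right inner_commute)
  qed
  have 1: "((\<lambda>v. \<sigma> v \<bullet> n) has_real_derivative tangent \<sigma> v \<bullet> n) (at v)" for v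
    unfolding has_real_derivative_iff_has_vector_derivative
    by (rule bounded_linear.has_vector_derivative[OF bounded_linear_inner_left \<sigma>])
  have 2: "((\<lambda>v. tangent \<sigma> v \<bullet> n) has_real_derivative (curvature \<sigma> a *\<^sub>R n) \<bullet> n) (at a)"
    unfolding has_real_derivative_iff_has_vector_derivative n_def
    by (rule bounded_linear.has_vector_derivative[OF bounded_linear_inner_left
          tangent_has_vector_derivative_curvature[OF unit diff]])
  have "(curvature \<sigma> a *\<^sub>R n) \<bullet> n \<ge> 0"
    by (rule second_derivative_nonneg_at_minimum[OF 1 2 side])
  then show ?thesis by (simp add: nn)
qed

section \<open>Motion of the nearest point\<close>

theorem lemma5:
  fixes K :: "(real^2) set" and \<sigma> :: "real \<Rightarrow> real^2"
    and T :: "real set" and c :: "real \<Rightarrow> real^2" and u r :: "real \<Rightarrow> real"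
  assumes "closed K" and "convex K" and "interior K \<noteq> {}"
    and "ccw_unit_speed_boundary K \<sigma>"
    and "\<And>v. tangent \<sigma> differentiable (at v)"
    and "is_interval T"
    and "\<And>t. t \<in> T \<Longrightarrow> c differentiable (at t within T)"
    and "\<And>t. t \<in> T \<Longrightarrow> c t \<notin> K"
    and "continuous_on T u"
    and "\<And>t. t \<in> T \<Longrightarrow> \<sigma> (u t) = closest_point K (c t)"
    and "\<And>t. t \<in> T \<Longrightarrow> r t = infdist (c t) K"
  shows "\<forall>t\<in>T.
      r t > 0 \<and>
      c t = \<sigma> (u t) - r t *\<^sub>R left_normal \<sigma> (u t) \<and>
      (u has_real_derivative
         (tangent \<sigma> (u t) \<bullet> vector_derivative c (at t within T)) / (1 + r t * curvature \<sigma> (u t)))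
        (at t within T) \<and>
      (r has_real_derivative
         - (left_normal \<sigma> (u t) \<bullet> vector_derivative c (at t within T)))
        (at t within T)"
proof
  fix t0 assume t0: "t0 \<in> T"
  note K = assms(1,2) and bd = assms(4) and diff = assms(5)
  define \<tau> where "\<tau> = tangent \<sigma>"
  define n where "n = left_normal \<sigma>"
  define \<kappa> where "\<kappa> = curvature \<sigma> (u t0)"
  define c' where "c' = vector_derivative c (at t0 within T)"
  have unit: "\<And>v. norm (\<tau> v) = 1"
    and \<sigma>: "\<And>v. (\<sigma> has_vector_derivative \<tau> v) (at v)"
    using bd by (auto simp: ccw_unit_speed_boundary_def \<tau>_def tangent_def vector_derivative_works)
  have n_eq: "n v = quarter_turn (\<tau> v)" for v
    by (simp add: n_def \<tau>_def left_normal_eq_quarter_turn)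
  have \<tau>\<tau> [simp]: "\<tau> v \<bullet> \<tau> v = 1" for v
    using unit[of v] by (simp add: norm_eq_1)
  have \<tau>': "(\<tau> has_vector_derivative \<kappa> *\<^sub>R n (u t0)) (at (u t0))"
    unfolding \<tau>_def n_def \<kappa>_def
    by (rule tangent_has_vector_derivative_curvature[OF unit[unfolded \<tau>_def] diff])
  have c': "(c has_vector_derivative c') (at t0 within T)"
    unfolding c'_def by (rule vector_derivative_works[THEN iffD1, OF assms(7)[OF t0]])
  have c_eq: "c t = \<sigma> (u t) - r t *\<^sub>R n (u t)" if "t \<in> T" for t
    using outer_point_eq_foot_minus_normal[OF K bd assms(10)[OF that]] assms(11)[OF that]
    by (simp add: n_def)
  have "K \<noteq> {}" using assms(3) by auto
  then have r_pos: "r t0 > 0"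
    using infdist_pos_not_in_closed[OF K(1)] assms(8,11)[OF t0] by simp
  have "\<kappa> \<ge> 0"
    unfolding \<kappa>_def by (rule curvature_nonneg_at_foot[OF K bd diff assms(8,10)[OF t0]])
  then have denom: "1 + r t0 * \<kappa> > 0"
    using r_pos by (simp add: add_pos_nonneg)
  have u_cont: "continuous (at t0 within T) u"
    using assms(9) t0 by (simp add: continuous_on_eq_continuous_within)

  have u': "(u has_real_derivative (c' \<bullet> \<tau> (u t0)) / (1 + r t0 * \<kappa>)) (at t0 within T)"
  proof (rule has_real_derivative_cancel_outer[OF _ _ u_cont])
    (* half the derivative of the squared distance from c t0 to the curve *)
    let ?h = "\<lambda>v. (\<sigma> v - c t0) \<bullet> \<tau> v"
    have 1: "((\<lambda>v. \<sigma> v - c t0) has_vector_derivative \<tau> (u t0)) (at (u t0))"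
      by (auto intro!: derivative_eq_intros \<sigma>)
    have "(?h has_vector_derivative
        (\<sigma> (u t0) - c t0) \<bullet> (\<kappa> *\<^sub>R n (u t0)) + \<tau> (u t0) \<bullet> \<tau> (u t0)) (at (u t0))"
      by (rule bounded_bilinear.has_vector_derivative[OF bounded_bilinear_inner 1 \<tau>'])
    moreover have "(\<sigma> (u t0) - c t0) \<bullet> (\<kappa> *\<^sub>R n (u t0)) = r t0 * \<kappa>"
      by (simp add: c_eq[OF t0] n_eq)
    ultimately show "(?h has_real_derivative 1 + r t0 * \<kappa>) (at (u t0))"
      by (simp only: has_real_derivative_iff_has_vector_derivative \<tau>\<tau> add.commute)
    show "1 + r t0 * \<kappa> \<noteq> 0" using denom by simp
    have 2: "((\<lambda>t. c t - c t0) has_vector_derivative c') (at t0 within T)"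
      by (auto intro!: derivative_eq_intros c')
    have "continuous (at t0 within T) (\<lambda>t. \<tau> (u t))"
      by (rule continuous_within_compose3[OF has_vector_derivative_continuous[OF \<tau>'] u_cont])
    from has_real_derivative_inner_continuous[OF 2 _ this]
    have "((\<lambda>t. (c t - c t0) \<bullet> \<tau> (u t)) has_real_derivative c' \<bullet> \<tau> (u t0)) (at t0 within T)"
      by simp
    moreover have "(c t - c t0) \<bullet> \<tau> (u t) = ?h (u t)" if "t \<in> T" for t
      by (simp add: c_eq[OF that] n_eq inner_diff_left)
    ultimately show "((\<lambda>t. ?h (u t)) has_real_derivative c' \<bullet> \<tau> (u t0)) (at t0 within T)"
      by (rule has_field_derivative_transform_within[OF _ zero_less_one t0])
  qed

  have r': "(r has_real_derivative - (n (u t0) \<bullet> c')) (at t0 within T)"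
  proof -
    define u' where "u' = (c' \<bullet> \<tau> (u t0)) / (1 + r t0 * \<kappa>)"
    have u_vec: "(u has_vector_derivative u') (at t0 within T)"
      using u' by (simp add: u'_def has_real_derivative_iff_has_vector_derivative)
    define n' where "n' = quarter_turn (\<kappa> *\<^sub>R n (u t0))"
    have n': "(n has_vector_derivative n') (at (u t0))"
      unfolding n'_def n_eq[abs_def]
      by (rule bounded_linear.has_vector_derivative[OF bounded_linear_quarter_turn
            \<tau>'[unfolded n_eq[abs_def]]])
    have nn': "n (u t0) \<bullet> n' = 0"
      using inner_derivative_of_unit_vector[OF n'] by (simp add: n_eq norm_eq_1 inner_commute)
    have 1: "((\<lambda>t. \<sigma> (u t) - c t) has_vector_derivative u' *\<^sub>R \<tau> (u t0) - c') (at t0 within T)"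
      using vector_diff_chain_within[OF u_vec has_vector_derivative_at_within[OF \<sigma>]] c'
      by (intro has_vector_derivative_diff) (auto simp: o_def)
    have 2: "((\<lambda>t. n (u t)) has_vector_derivative u' *\<^sub>R n') (at t0 within T)"
      using vector_diff_chain_within[OF u_vec has_vector_derivative_at_within[OF n']]
      by (simp add: o_def)
    have "((\<lambda>t. (\<sigma> (u t) - c t) \<bullet> n (u t)) has_vector_derivative
        (\<sigma> (u t0) - c t0) \<bullet> (u' *\<^sub>R n') + (u' *\<^sub>R \<tau> (u t0) - c') \<bullet> n (u t0)) (at t0 within T)"
      by (rule bounded_bilinear.has_vector_derivative[OF bounded_bilinear_inner 1 2])
    moreover have "(\<sigma> (u t0) - c t0) \<bullet> (u' *\<^sub>R n') = 0"
      by (simp add: c_eq[OF t0] nn')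
    moreover have "(u' *\<^sub>R \<tau> (u t0) - c') \<bullet> n (u t0) = - (n (u t0) \<bullet> c')"
      by (simp add: inner_diff_left n_eq inner_commute[of c'])
    ultimately have "((\<lambda>t. (\<sigma> (u t) - c t) \<bullet> n (u t)) has_real_derivative - (n (u t0) \<bullet> c'))
        (at t0 within T)"
      by (simp only: has_real_derivative_iff_has_vector_derivative add_0)
    moreover have "(\<sigma> (u t) - c t) \<bullet> n (u t) = r t" if "t \<in> T" for t
      by (simp add: c_eq[OF that] n_eq)
    ultimately show ?thesis
      by (rule has_field_derivative_transform_within[OF _ zero_less_one t0])
  qed

  show "r t0 > 0 \<and>
      c t0 = \<sigma> (u t0) - r t0 *\<^sub>R left_normal \<sigma> (u t0) \<and>
      (u has_real_derivative
         (tangent \<sigma> (u t0) \<bullet> vector_derivative c (at t0 within T)) / (1 + r t0 * curvature \<sigma> (u t0)))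
        (at t0 within T) \<and>
      (r has_real_derivative
         - (left_normal \<sigma> (u t0) \<bullet> vector_derivative c (at t0 within T)))
        (at t0 within T)"
    using r_pos c_eq[OF t0] u' r' by (simp add: n_def \<tau>_def \<kappa>_def c'_def inner_commute)
qed

end
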